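(* Let $A,A'\subseteq\mathbb{R}$ be disjoint sets of cardinality $\mathfrak{c}$ such that $\mu_*(A)=\mu_*(A')=\mu_*(\mathbb{R}\setminus A)=\mu_*(\mathbb{R}\setminus A')=0$ and $A\cup A'$ is algebraically independent over $\mathbb{Q}$. Set $\sqrt{A_{\geq 0}}=\{\sqrt{a}\mid a\in A,\ a\geq 0\}$ and $K=\mathbb{Q}\left(\sqrt{A_{\geq 0}}\cup A'\right)\subseteq\mathbb{R}$. Then the field $K$ admits $2^{\mathfrak{c}}$ many pairwise non-isomorphic archimedean orderings and $2^{\mathfrak{c}}$ many pairwise non-isomorphic non-archimedean orderings.
   Context: The set theory is ZFC, and $\mathfrak{c}=2^{\aleph_0}$ is the cardinality of the continuum. $\mathcal{B}(\mathbb{R})$ denotes the Borel $\sigma$-algebra on $\mathbb{R}$ and $\mu$ the unique measure on $\mathcal{B}(\mathbb{R})$ that maps each interval $(a,b)$ with $a<b$ in $\mathbb{R}$ to its length $b-a$. For $M\subseteq\mathbb{R}$, the inner measure of $M$ is $\mu_*(M)=\max\{\mu(B)\mid B\in\mathcal{B}(\mathbb{R}),\,B\subseteq M\}\in[0,\infty]$ (this maximum is always attained). An ordering on a field $F$ is a linear ordering making $F$ an ordered field. Two orderings $<$ and $<'$ on $F$ are isomorphic if there exists an order-preserving field isomorphism from $(F,<)$ to $(F,<')$. *)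

theory Defs
  imports
    "HOL-Analysis.Analysis"
    "HOL-Algebra.Algebraic_Closure_Type"
    "HOL-Algebra.Generated_Fields"
    "HOL-Library.Poly_Mapping"
    "HOL-Library.Equipollence"
begin

definition inner_measure :: "real set \<Rightarrow> ennreal" where
  "inner_measure M = (SUP B \<in> {B \<in> sets borel. B \<subseteq> M}. emeasure lborel B)"

lemma inner_measure_attained:
  "\<exists>B \<in> sets borel. B \<subseteq> M \<and> emeasure lborel B = inner_measure M"
proof -
  let ?X = "{B \<in> sets borel. B \<subseteq> M}"
  have "{} \<in> ?X" by simp
  then have "?X \<noteq> {}" by blast
  from ennreal_SUP_countable_SUP[OF this, of "emeasure lborel"]
  obtain f :: "nat \<Rightarrow> ennreal" where f: "range f \<subseteq> emeasure lborel ` ?X"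
    "(SUP B\<in>?X. emeasure lborel B) = (SUP i. f i)" by blast
  have "\<forall>i. \<exists>B\<in>?X. f i = emeasure lborel B" using f(1) by blast
  then obtain C where C: "\<And>i. C i \<in> ?X" "\<And>i. f i = emeasure lborel (C i)" by metis
  have U: "(\<Union>i. C i) \<in> ?X" using C(1) by blast
  have "f i \<le> emeasure lborel (\<Union>i. C i)" for i
    unfolding C(2) using U by (intro emeasure_mono) auto
  then have "inner_measure M \<le> emeasure lborel (\<Union>i. C i)"
    unfolding inner_measure_def f(2) by (intro SUP_least)
  moreover have "emeasure lborel (\<Union>i. C i) \<le> inner_measure M"
    unfolding inner_measure_def using U by (intro SUP_upper)
  ultimately show ?thesis using U by (intro bexI[of _ "\<Union>i. C i"]) auto
qed

text \<open>
  A polynomial over \<open>\<rat>\<close> in variables indexed by real numbers is a finitely supported map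
  from monomials to coefficients, a monomial being a finitely supported map from variables
  to exponents. It is evaluated by substituting for each variable the real number indexing it.
\<close>

type_synonym real_indexed_poly = "(real \<Rightarrow>\<^sub>0 nat) \<Rightarrow>\<^sub>0 rat"

definition poly_variables :: "real_indexed_poly \<Rightarrow> real set" where
  "poly_variables p = (\<Union>m \<in> Poly_Mapping.keys p. Poly_Mapping.keys m)"

definition eval_at_indices :: "real_indexed_poly \<Rightarrow> real" where
  "eval_at_indices p =
    (\<Sum>m \<in> Poly_Mapping.keys p. of_rat (Poly_Mapping.lookup p m) *
      (\<Prod>x \<in> Poly_Mapping.keys m. x ^ Poly_Mapping.lookup m x))"

definition algebraically_independent_over_rat :: "real set \<Rightarrow> bool" where
  "algebraically_independent_over_rat S \<longleftrightarrow>
    (\<forall>p. poly_variables p \<subseteq> S \<and> eval_at_indices p = 0 \<longrightarrow> p = 0)"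

text \<open>
  The subfield of \<open>\<real>\<close> generated by \<open>S\<close> contains the prime field, hence it is \<open>\<rat>(S)\<close>.
\<close>

definition rat_adjoin :: "real set \<Rightarrow> real ring" where
  "rat_adjoin S = ring_of_type_algebra\<lparr>carrier := generate_field ring_of_type_algebra S\<rparr>"

lemma field_rat_adjoin: "field (rat_adjoin S)"
proof -
  interpret R: field "ring_of_type_algebra :: real ring" by (rule field_from_type_algebra)
  show ?thesis
    unfolding rat_adjoin_def by (rule R.generate_field_is_field) (simp add: ring_of_type_algebra_def)
qed

text \<open>
  An ordering is given by its reflexive relation \<open>\<le>\<close>. Since \<open>linear_order_on\<close> forces
  \<open>r \<subseteq> carrier F \<times> carrier F\<close>, different relations are different orderings of \<open>F\<close>.
\<close>

definition field_ordering :: "('a, 'b) ring_scheme \<Rightarrow> 'a rel \<Rightarrow> bool" where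
  "field_ordering F r \<longleftrightarrow>
    linear_order_on (carrier F) r \<and>
    (\<forall>x \<in> carrier F. \<forall>y \<in> carrier F. \<forall>z \<in> carrier F.
      (x, y) \<in> r \<longrightarrow> (x \<oplus>\<^bsub>F\<^esub> z, y \<oplus>\<^bsub>F\<^esub> z) \<in> r) \<and>
    (\<forall>x \<in> carrier F. \<forall>y \<in> carrier F.
      (\<zero>\<^bsub>F\<^esub>, x) \<in> r \<and> (\<zero>\<^bsub>F\<^esub>, y) \<in> r \<longrightarrow> (\<zero>\<^bsub>F\<^esub>, x \<otimes>\<^bsub>F\<^esub> y) \<in> r)"

definition archimedean :: "('a, 'b) ring_scheme \<Rightarrow> 'a rel \<Rightarrow> bool" where
  "archimedean F r \<longleftrightarrow> (\<forall>x \<in> carrier F. \<exists>n::nat. (x, [n] \<cdot>\<^bsub>F\<^esub> \<one>\<^bsub>F\<^esub>) \<in> r)"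

definition isomorphic_orderings :: "('a, 'b) ring_scheme \<Rightarrow> 'a rel \<Rightarrow> 'a rel \<Rightarrow> bool" where
  "isomorphic_orderings F r s \<longleftrightarrow>
    (\<exists>h \<in> ring_iso F F. \<forall>x \<in> carrier F. \<forall>y \<in> carrier F. (x, y) \<in> r \<longleftrightarrow> (h x, h y) \<in> s)"

end

theory Submission
  imports Defs "HOL-Computational_Algebra.Fraction_Field"
begin

text \<open>
  With \<open>V = {a \<in> A. a \<ge> 0} \<union> A'\<close>, replacing nonnegative elements of \<open>V\<close> by their
  square roots preserves algebraic independence, so \<open>K\<close> is a purely transcendental extension of
  \<open>\<rat>\<close> of continuum degree. Split off disjoint \<open>B, C \<subseteq> V\<close> of continuum cardinality.
  For \<open>D \<subseteq> C\<close> a bijection \<open>V \<rightarrow> B \<union> D\<close> induces a field embedding \<open>K \<rightarrow> \<real>\<close> with image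
  \<open>\<rat>(B \<union> D)\<close>; sending one generator, the preimage of a fixed \<open>b \<in> B\<close>, to an infinitely large
  element instead gives an embedding \<open>K \<rightarrow> \<real>(X)\<close>.
  The set of real numbers whose rational cut is realized by an element of \<open>K\<close> is an isomorphism
  invariant of the ordering. It equals \<open>\<rat>(B \<union> D)\<close> in the first case and
  \<open>\<rat>((B - {b}) \<union> D)\<close> in the second, and meets \<open>C\<close> exactly in \<open>D\<close>.
\<close>

section \<open>Evaluation of polynomials\<close>

text \<open>Homomorphisms are plain functions between types, so embeddings of coefficients,
  evaluations and substitutions all share one set of rewrite rules.\<close>

locale comm_ring_hom =
  fixes h :: "'a::comm_ring_1 \<Rightarrow> 'b::comm_ring_1"
  assumes hom_add: "h (x + y) = h x + h y"
    and hom_mult: "h (x * y) = h x * h y"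
    and hom_one: "h 1 = 1"
begin

lemma hom_zero: "h 0 = 0"
  using hom_add[of 0 0] by simp

lemma hom_uminus: "h (- x) = - h x"
  using hom_add[of x "- x"] by (simp add: hom_zero eq_neg_iff_add_eq_0 add.commute)

lemma hom_diff: "h (x - y) = h x - h y"
  using hom_add[of x "- y"] by (simp add: hom_uminus)

lemma hom_power: "h (x ^ n) = h x ^ n"
  by (induction n) (simp_all add: hom_one hom_mult)

lemma hom_sum: "h (sum f A) = (\<Sum>x\<in>A. h (f x))"
  by (induction A rule: infinite_finite_induct) (simp_all add: hom_zero hom_add)

lemma hom_prod: "h (prod f A) = (\<Prod>x\<in>A. h (f x))"
  by (induction A rule: infinite_finite_induct) (simp_all add: hom_one hom_mult)

end

lemmas hom_simps = comm_ring_hom.hom_add comm_ring_hom.hom_mult comm_ring_hom.hom_one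
  comm_ring_hom.hom_zero comm_ring_hom.hom_uminus comm_ring_hom.hom_diff
  comm_ring_hom.hom_power

lemma comm_ring_hom_comp:
  "comm_ring_hom g \<Longrightarrow> comm_ring_hom h \<Longrightarrow> comm_ring_hom (\<lambda>x. g (h x))"
  by (simp add: comm_ring_hom_def)

lemma comm_ring_hom_of_rat: "comm_ring_hom (of_rat :: rat \<Rightarrow> 'a::field_char_0)"
  by unfold_locales (simp_all add: of_rat_add of_rat_mult)

definition eval_monom :: "(real \<Rightarrow> 'a::comm_ring_1) \<Rightarrow> (real \<Rightarrow>\<^sub>0 nat) \<Rightarrow> 'a" where
  "eval_monom f m = (\<Prod>x\<in>Poly_Mapping.keys m. f x ^ Poly_Mapping.lookup m x)"

text \<open>The coefficient map \<open>c\<close> is a parameter because evaluation takes place in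
  several rings: with \<open>of_rat\<close> in the reals, with \<open>const_poly\<close> as
  substitution, and with constants in a polynomial ring or its fraction field.\<close>

definition eval_poly ::
  "(rat \<Rightarrow> 'a::comm_ring_1) \<Rightarrow> (real \<Rightarrow> 'a) \<Rightarrow> real_indexed_poly \<Rightarrow> 'a" where
  "eval_poly c f p =
    (\<Sum>m\<in>Poly_Mapping.keys p. c (Poly_Mapping.lookup p m) * eval_monom f m)"

definition const_poly :: "rat \<Rightarrow> real_indexed_poly" where
  "const_poly a = Poly_Mapping.single 0 a"

definition var_poly :: "real \<Rightarrow> real_indexed_poly" where
  "var_poly x = Poly_Mapping.single (Poly_Mapping.single x 1) 1"

lemma eval_at_indices_eq: "eval_at_indices p = eval_poly of_rat (\<lambda>x. x) p"
  by (simp add: eval_at_indices_def eval_poly_def eval_monom_def)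

lemma poly_mapping_eq_sum_single:
  "p = (\<Sum>m\<in>Poly_Mapping.keys p. Poly_Mapping.single m (Poly_Mapping.lookup p m))"
  by (rule poly_mapping_eqI)
     (auto simp: lookup_sum lookup_single when_def sum.delta in_keys_iff)

text \<open>Variables outside the support contribute a zeroth power, so monomials with different
  supports can be compared over one index set.\<close>

lemma eval_monom_superset:
  assumes "finite S" "Poly_Mapping.keys m \<subseteq> S"
  shows "eval_monom f m = (\<Prod>x\<in>S. f x ^ Poly_Mapping.lookup m x)"
  unfolding eval_monom_def using assms
  by (intro prod.mono_neutral_left) (auto simp: in_keys_iff)

lemma eval_monom_add: "eval_monom f (m + n) = eval_monom f m * eval_monom f n"
proof -
  let ?S = "Poly_Mapping.keys m \<union> Poly_Mapping.keys n"
  have "finite ?S" by simp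
  note sup = eval_monom_superset[OF this, of _ f]
  show ?thesis
    using sup[of m] sup[of n] sup[of "m + n"] Poly_Mapping.keys_add[of m n]
    by (simp add: lookup_add power_add prod.distrib)
qed

context
  fixes c :: "rat \<Rightarrow> 'a::comm_ring_1" and f :: "real \<Rightarrow> 'a"
  assumes c: "comm_ring_hom c"
begin

lemmas c_simps = hom_simps[OF c]

lemma eval_poly_superset:
  assumes "finite S" "Poly_Mapping.keys p \<subseteq> S"
  shows "eval_poly c f p = (\<Sum>m\<in>S. c (Poly_Mapping.lookup p m) * eval_monom f m)"
  unfolding eval_poly_def using assms
  by (intro sum.mono_neutral_left) (auto simp: in_keys_iff c_simps)

lemma eval_poly_add: "eval_poly c f (p + q) = eval_poly c f p + eval_poly c f q"
proof -
  let ?S = "Poly_Mapping.keys p \<union> Poly_Mapping.keys q"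
  have "finite ?S" by simp
  note sup = eval_poly_superset[OF this]
  show ?thesis
    using sup[of p] sup[of q] sup[of "p + q"] Poly_Mapping.keys_add[of p q]
    by (simp add: lookup_add c_simps distrib_right sum.distrib)
qed

lemma eval_poly_sum: "eval_poly c f (sum g A) = (\<Sum>x\<in>A. eval_poly c f (g x))"
  by (induction A rule: infinite_finite_induct)
     (simp_all add: eval_poly_add, simp_all add: eval_poly_def)

lemma eval_poly_single: "eval_poly c f (Poly_Mapping.single m a) = c a * eval_monom f m"
  by (simp add: eval_poly_def c_simps)

lemma eval_poly_mult: "eval_poly c f (p * q) = eval_poly c f p * eval_poly c f q"
proof -
  let ?s = "\<lambda>p m. Poly_Mapping.single m (Poly_Mapping.lookup p m) :: real_indexed_poly"
  have "p * q = (\<Sum>m\<in>Poly_Mapping.keys p. \<Sum>n\<in>Poly_Mapping.keys q. ?s p m * ?s q n)"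
    by (subst poly_mapping_eq_sum_single[of p], subst poly_mapping_eq_sum_single[of q])
       (rule sum_product)
  then show ?thesis
    by (simp add: eval_poly_sum mult_single eval_poly_single eval_monom_add c_simps
        eval_poly_def[of c f p] eval_poly_def[of c f q] sum_product mult_ac)
qed

lemma comm_ring_hom_eval_poly: "comm_ring_hom (eval_poly c f)"
proof
  show "eval_poly c f 1 = 1"
    using eval_poly_single[of 0 1] by (simp add: c_simps eval_monom_def)
qed (rule eval_poly_add, rule eval_poly_mult)

lemma eval_poly_const: "eval_poly c f (const_poly a) = c a"
  by (simp add: const_poly_def eval_poly_single eval_monom_def)

lemma eval_poly_var: "eval_poly c f (var_poly x) = f x"
  by (simp add: var_poly_def eval_poly_single eval_monom_def c_simps)

lemma hom_eval_poly:
  assumes "comm_ring_hom h"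
  shows "h (eval_poly c f p) = eval_poly (\<lambda>a. h (c a)) (\<lambda>x. h (f x)) p"
  using assms
  by (simp add: eval_poly_def eval_monom_def comm_ring_hom.hom_sum comm_ring_hom.hom_prod
      comm_ring_hom.hom_mult comm_ring_hom.hom_power)

end

lemma eval_poly_cong:
  assumes "\<And>x. x \<in> poly_variables p \<Longrightarrow> f x = g x"
  shows "eval_poly c f p = eval_poly c g p"
proof -
  have "f x = g x" if "m \<in> Poly_Mapping.keys p" "x \<in> Poly_Mapping.keys m" for m x
    using assms that by (auto simp: poly_variables_def)
  then show ?thesis
    unfolding eval_poly_def eval_monom_def by simp
qed

text \<open>Besides membership, this yields induction on polynomials: applied to the identity
  substitution of \<open>eval_poly_self\<close>, it shows that a property of constants and variables
  closed under sums and products holds for \<open>p\<close> itself.\<close>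

lemma eval_poly_in_subring:
  assumes "\<And>a. c a \<in> R" "\<And>x. x \<in> poly_variables p \<Longrightarrow> f x \<in> R" "1 \<in> R" "0 \<in> R"
    and add: "\<And>x y. x \<in> R \<Longrightarrow> y \<in> R \<Longrightarrow> x + y \<in> R"
    and mult: "\<And>x y. x \<in> R \<Longrightarrow> y \<in> R \<Longrightarrow> x * y \<in> R"
  shows "eval_poly c f p \<in> R"
proof -
  have pow: "x ^ n \<in> R" if "x \<in> R" for x and n :: nat
    by (induction n) (use that assms in auto)
  have prod: "prod g S \<in> R" if "\<And>x. x \<in> S \<Longrightarrow> g x \<in> R" for g and S :: "real set"
    using that by (induction S rule: infinite_finite_induct) (use assms in auto)
  have sum: "sum g S \<in> R" if "\<And>x. x \<in> S \<Longrightarrow> g x \<in> R" for g and S :: "(real \<Rightarrow>\<^sub>0 nat) set"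
    using that by (induction S rule: infinite_finite_induct) (use assms in auto)
  show ?thesis unfolding eval_poly_def eval_monom_def
    by (intro sum mult prod pow assms) (auto simp: poly_variables_def)
qed

lemma comm_ring_hom_const_poly: "comm_ring_hom const_poly"
  by unfold_locales (simp_all add: const_poly_def single_add mult_single)

lemma eval_poly_self: "eval_poly const_poly var_poly p = p"
proof -
  have pow: "var_poly x ^ k = Poly_Mapping.single (Poly_Mapping.single x k) 1" for x k
    by (induction k) (simp_all add: var_poly_def mult_single flip: single_add)
  have prod: "(\<Prod>x\<in>S. Poly_Mapping.single (g x) 1) = (Poly_Mapping.single (sum g S) 1 :: real_indexed_poly)"
    for g :: "real \<Rightarrow> _" and S
    by (induction S rule: infinite_finite_induct) (simp_all add: mult_single)
  have mon: "eval_monom var_poly m = Poly_Mapping.single m 1" for m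
    unfolding eval_monom_def pow prod
    by (subst poly_mapping_eq_sum_single[symmetric]) simp
  show ?thesis
    unfolding eval_poly_def mon const_poly_def mult_single
    by (simp flip: poly_mapping_eq_sum_single)
qed

section \<open>Polynomials in a prescribed set of variables\<close>

definition polys_over :: "real set \<Rightarrow> real_indexed_poly set" where
  "polys_over V = {p. poly_variables p \<subseteq> V}"

lemma polys_over_const: "const_poly a \<in> polys_over V"
  by (auto simp: polys_over_def poly_variables_def const_poly_def split: if_splits)

lemma polys_over_var: "x \<in> V \<Longrightarrow> var_poly x \<in> polys_over V"
  by (auto simp: polys_over_def poly_variables_def var_poly_def)

lemma polys_over_add: "p \<in> polys_over V \<Longrightarrow> q \<in> polys_over V \<Longrightarrow> p + q \<in> polys_over V"
  using Poly_Mapping.keys_add[of p q] unfolding polys_over_def poly_variables_def by blast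

lemma polys_over_mult:
  assumes "p \<in> polys_over V" "q \<in> polys_over V"
  shows "p * q \<in> polys_over V"
proof -
  have "x \<in> V" if m: "m \<in> Poly_Mapping.keys (p * q)" and x: "x \<in> Poly_Mapping.keys m" for m x
  proof -
    obtain a b where "a \<in> Poly_Mapping.keys p" "b \<in> Poly_Mapping.keys q" "m = a + b"
      using m keys_mult[of p q] by blast
    moreover have "x \<in> Poly_Mapping.keys a \<union> Poly_Mapping.keys b"
      using x Poly_Mapping.keys_add[of a b] \<open>m = a + b\<close> by blast
    ultimately show ?thesis
      using assms unfolding polys_over_def poly_variables_def by blast
  qed
  then show ?thesis by (auto simp: polys_over_def poly_variables_def)
qed

lemma polys_over_0: "0 \<in> polys_over V"
  and polys_over_1: "1 \<in> polys_over V"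
  using polys_over_const[of 0 V] polys_over_const[of 1 V] by (simp_all add: const_poly_def)

lemma polys_over_uminus: "p \<in> polys_over V \<Longrightarrow> - p \<in> polys_over V"
  by (simp add: polys_over_def poly_variables_def)

lemma polys_over_diff: "p \<in> polys_over V \<Longrightarrow> q \<in> polys_over V \<Longrightarrow> p - q \<in> polys_over V"
  using polys_over_add[of p V "- q"] polys_over_uminus[of q V] by simp

lemma polys_over_eval:
  assumes "p \<in> polys_over V" "\<And>x. x \<in> V \<Longrightarrow> f x \<in> polys_over W"
  shows "eval_poly const_poly f p \<in> polys_over W"
  using assms
  by (intro eval_poly_in_subring)
     (auto simp: polys_over_def[of V] intro: polys_over_const polys_over_0 polys_over_1
       polys_over_add polys_over_mult)

section \<open>Algebraic independence\<close>

text \<open>Independence is stated for an indexed family in an arbitrary ring, so that one index set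
  \<open>V\<close> serves both for the generators of \<open>K\<close> and for their images under an
  embedding.\<close>

definition alg_indep :: "(rat \<Rightarrow> 'a::comm_ring_1) \<Rightarrow> (real \<Rightarrow> 'a) \<Rightarrow> real set \<Rightarrow> bool" where
  "alg_indep c f V \<longleftrightarrow> (\<forall>p\<in>polys_over V. eval_poly c f p = 0 \<longrightarrow> p = 0)"

lemma alg_indepD: "alg_indep c f V \<Longrightarrow> p \<in> polys_over V \<Longrightarrow> eval_poly c f p = 0 \<Longrightarrow> p = 0"
  by (simp add: alg_indep_def)

lemma algebraically_independent_over_rat_iff:
  "algebraically_independent_over_rat V \<longleftrightarrow> alg_indep of_rat (\<lambda>x. x) V"
  by (auto simp: algebraically_independent_over_rat_def alg_indep_def polys_over_def
      eval_at_indices_eq)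

lemma eval_poly_eval_poly:
  assumes "comm_ring_hom c"
  shows "eval_poly c f (eval_poly const_poly s p) = eval_poly c (\<lambda>x. eval_poly c f (s x)) p"
  using hom_eval_poly[OF comm_ring_hom_const_poly comm_ring_hom_eval_poly[OF assms]]
  by (simp add: eval_poly_const[OF assms])

lemma eval_poly_self_cong:
  assumes "p \<in> polys_over V" "\<And>x. x \<in> V \<Longrightarrow> s x = var_poly x"
  shows "eval_poly const_poly s p = p"
proof -
  have "eval_poly const_poly s p = eval_poly const_poly var_poly p"
    using assms by (intro eval_poly_cong) (auto simp: polys_over_def)
  then show ?thesis by (simp add: eval_poly_self)
qed

section \<open>Independence after taking square roots\<close>

abbreviation square_var :: "real \<Rightarrow> real_indexed_poly \<Rightarrow> real_indexed_poly" where
  "square_var a \<equiv> eval_poly const_poly (var_poly(a := var_poly a * var_poly a))"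

abbreviation negate_var :: "real \<Rightarrow> real_indexed_poly \<Rightarrow> real_indexed_poly" where
  "negate_var a \<equiv> eval_poly const_poly (var_poly(a := - var_poly a))"

text \<open>Monomials are sorted by the parity of the exponent of \<open>a\<close>. Sums of this
  shape are closed under products: two odd parts multiply to an even one, since
  \<open>var_poly a * var_poly a\<close> is the image of \<open>var_poly a\<close> under
  \<open>square_var a\<close>.\<close>

lemma even_odd_decomposition:
  assumes "p \<in> polys_over V" "a \<in> V"
  obtains q r where "q \<in> polys_over V" "r \<in> polys_over V"
    "p = square_var a q + var_poly a * square_var a r"
proof -
  let ?S = "square_var a"
  note hom = comm_ring_hom_eval_poly[OF comm_ring_hom_const_poly]
  define R where "R = {p. \<exists>q\<in>polys_over V. \<exists>r\<in>polys_over V. p = ?S q + var_poly a * ?S r}"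
  have RI: "?S q + var_poly a * ?S r \<in> R" if "q \<in> polys_over V" "r \<in> polys_over V" for q r
    using that by (auto simp: R_def)
  have const: "const_poly x \<in> R" for x
    using RI[OF polys_over_const[of x] polys_over_0]
    by (simp add: eval_poly_const comm_ring_hom_const_poly hom_simps[OF hom])
  have "eval_poly const_poly var_poly p \<in> R"
  proof (rule eval_poly_in_subring)
    show "const_poly x \<in> R" for x by (rule const)
    show "1 \<in> R" "0 \<in> R"
      using const[of 1] const[of 0] by (simp_all add: const_poly_def)
    show "var_poly x \<in> R" if "x \<in> poly_variables p" for x
    proof (cases "x = a")
      case True
      then show ?thesis
        using RI[OF polys_over_0 polys_over_1] by (simp add: hom_simps[OF hom])
    next
      case False
      have "x \<in> V" using that assms by (auto simp: polys_over_def)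
      then show ?thesis
        using RI[OF polys_over_var[of x] polys_over_0] False
        by (simp add: hom_simps[OF hom] eval_poly_var comm_ring_hom_const_poly)
    qed
    fix x y assume "x \<in> R" "y \<in> R"
    then obtain q r q' r' where *: "q \<in> polys_over V" "r \<in> polys_over V"
      "q' \<in> polys_over V" "r' \<in> polys_over V"
      "x = ?S q + var_poly a * ?S r" "y = ?S q' + var_poly a * ?S r'"
      by (auto simp: R_def)
    show "x + y \<in> R"
      using RI[of "q + q'" "r + r'"] *
      by (simp add: polys_over_add hom_simps[OF hom] algebra_simps)
    have "x * y = ?S (q * q' + var_poly a * r * r') + var_poly a * ?S (q * r' + q' * r)"
      by (simp add: * hom_simps[OF hom] eval_poly_var comm_ring_hom_const_poly algebra_simps)
    then show "x * y \<in> R"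
      using RI[of "q * q' + var_poly a * r * r'" "q * r' + q' * r"] *
      by (simp add: polys_over_add polys_over_mult polys_over_var assms)
  qed
  then show ?thesis
    using that by (auto simp: R_def eval_poly_self)
qed

lemma negate_var_involution: "negate_var a (negate_var a p) = p"
proof -
  have "(\<lambda>x. negate_var a ((var_poly(a := - var_poly a)) x)) = var_poly"
    by (auto simp: eval_poly_var comm_ring_hom_const_poly
        hom_simps[OF comm_ring_hom_eval_poly[OF comm_ring_hom_const_poly]])
  then show ?thesis
    by (simp add: eval_poly_eval_poly comm_ring_hom_const_poly eval_poly_self del: fun_upd_apply)
qed

lemma negate_var_polys_over: "a \<in> V \<Longrightarrow> p \<in> polys_over V \<Longrightarrow> negate_var a p \<in> polys_over V"
  by (rule polys_over_eval) (auto intro: polys_over_var polys_over_uminus)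

text \<open>Splitting a relation for the new family into even and odd part and squaring gives a
  relation \<open>q * q = var_poly a * (r * r)\<close> at the old values, hence an identity of
  polynomials. Such an identity forces \<open>q\<close> and \<open>r\<close> to vanish.\<close>

lemma alg_indep_sqrt:
  assumes indep: "alg_indep of_rat g V" and a: "a \<in> V" "0 \<le> g a"
  shows "alg_indep of_rat (g(a := sqrt (g a))) V"
\<comment> \<open>At zero the root changes nothing. Otherwise \<open>g a\<close> is positive, which
  is what separates the two summands of the final sum of squares.\<close>
proof (cases "g a = 0")
  case True
  then have "g(a := sqrt (g a)) = g" by auto
  then show ?thesis using indep by simp
next
  case False
  let ?g = "g(a := sqrt (g a))" and ?E = "eval_poly of_rat :: _ \<Rightarrow> _ \<Rightarrow> real"
  note rat = comm_ring_hom_of_rat[where 'a = real]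
  note hom = comm_ring_hom_eval_poly[OF rat]
  note chom = comm_ring_hom_eval_poly[OF comm_ring_hom_const_poly]
  show ?thesis unfolding alg_indep_def
  proof (intro ballI impI)
    fix p assume p: "p \<in> polys_over V" "?E ?g p = 0"
    from even_odd_decomposition[OF p(1) a(1)]
    obtain q r where qr: "q \<in> polys_over V" "r \<in> polys_over V"
      "p = square_var a q + var_poly a * square_var a r" .
    \<comment> \<open>Squaring the variable undoes the root: evaluating
      \<open>square_var a s\<close> at the new values is evaluating \<open>s\<close> at the old
      ones.\<close>
    have "(\<lambda>x. ?E ?g ((var_poly(a := var_poly a * var_poly a)) x)) = g"
      using a by (auto simp: eval_poly_var[OF rat] hom_simps[OF hom])
    then have sq: "?E ?g (square_var a s) = ?E g s" for s
      by (simp add: eval_poly_eval_poly[OF rat] del: fun_upd_apply)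
    have "?E g q + sqrt (g a) * ?E g r = 0"
      using p(2) by (simp add: qr(3) hom_simps[OF hom] sq eval_poly_var[OF rat])
    then have "(?E g q)\<^sup>2 = (sqrt (g a) * ?E g r)\<^sup>2"
      by (metis add_eq_0_iff power2_minus)
    then have "?E g (q * q - var_poly a * (r * r)) = 0"
      using a by (simp add: hom_simps[OF hom] eval_poly_var[OF rat] power_mult_distrib
          flip: power2_eq_square)
    then have "q * q - var_poly a * (r * r) = 0"
      by (intro alg_indepD[OF indep])
         (auto intro!: qr a polys_over_diff polys_over_mult polys_over_var)
    \<comment> \<open>Substituting \<open>-X\<^sub>a\<close> for \<open>X\<^sub>a\<close> in \<open>q\<^sup>2 = X\<^sub>a r\<^sup>2\<close> and evaluating at \<open>g\<close> makes the two sides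
      have opposite signs, so both vanish.\<close>
    then have "?E g (negate_var a (q * q - var_poly a * (r * r))) = 0"
      by (simp add: hom_simps[OF hom] hom_simps[OF chom])
    then have "(?E g (negate_var a q))\<^sup>2 + g a * (?E g (negate_var a r))\<^sup>2 = 0"
      by (simp add: hom_simps[OF hom] hom_simps[OF chom] eval_poly_var[OF rat]
          eval_poly_var[OF comm_ring_hom_const_poly] power2_eq_square)
    then have "?E g (negate_var a q) = 0" "?E g (negate_var a r) = 0"
      using False a by (simp_all add: add_nonneg_eq_0_iff)
    then have "negate_var a q = 0" "negate_var a r = 0"
      using alg_indepD[OF indep negate_var_polys_over] a qr by blast+
    then have "q = 0" "r = 0"
      using negate_var_involution[of a q] negate_var_involution[of a r]
      by (simp_all add: hom_simps[OF chom])
    then show "p = 0"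
      by (simp add: qr hom_simps[OF chom])
  qed
qed

text \<open>A polynomial involves finitely many variables, so it suffices to replace values one at a
  time over a finite set.\<close>

lemma alg_indep_sqrt_on:
  assumes indep: "alg_indep of_rat g V" and F: "\<And>x. x \<in> F \<Longrightarrow> 0 \<le> g x"
  shows "alg_indep of_rat (\<lambda>x. if x \<in> F then sqrt (g x) else g x) V"
proof -
  let ?g = "\<lambda>F x. if x \<in> F then sqrt (g x) else g x"
  have fin: "alg_indep of_rat (?g S) V" if "finite S" "S \<subseteq> F \<inter> V" for S
    using that
  proof (induction S)
    case (insert a S)
    then have "?g (insert a S) = (?g S)(a := sqrt (?g S a))" by auto
    then show ?case
      using alg_indep_sqrt[of "?g S" V a] insert F by auto
  qed (simp add: indep)
  show ?thesis unfolding alg_indep_def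
  proof (intro ballI impI)
    fix p assume p: "p \<in> polys_over V" "eval_poly of_rat (?g F) p = 0"
    have "eval_poly of_rat (?g (F \<inter> poly_variables p)) p = eval_poly of_rat (?g F) p"
      by (intro eval_poly_cong) auto
    moreover have "finite (poly_variables p)" by (simp add: poly_variables_def)
    ultimately show "p = 0"
      using p fin[of "F \<inter> poly_variables p"] by (auto simp: alg_indep_def polys_over_def)
  qed
qed

section \<open>Fields of fractions inside the reals\<close>

text \<open>The field generated by the values of \<open>g\<close> on \<open>V\<close>, with every
  element presented as a quotient. This form, unlike generation by closure, allows maps to be
  defined on it.\<close>

definition fractions :: "(real \<Rightarrow> real) \<Rightarrow> real set \<Rightarrow> real set" where
  "fractions g V = {eval_poly of_rat g p / eval_poly of_rat g q | p q.
    p \<in> polys_over V \<and> q \<in> polys_over V \<and> eval_poly of_rat g q \<noteq> 0}"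

text \<open>Since \<open>inverse 0 = 0\<close>, closure under \<open>inverse\<close> carries no side
  condition.\<close>

definition real_subfield :: "real set \<Rightarrow> bool" where
  "real_subfield K \<longleftrightarrow> 1 \<in> K \<and> (\<forall>x\<in>K. - x \<in> K \<and> inverse x \<in> K) \<and>
    (\<forall>x\<in>K. \<forall>y\<in>K. x + y \<in> K \<and> x * y \<in> K)"

lemma real_subfieldD:
  assumes "real_subfield K"
  shows "1 \<in> K" "x \<in> K \<Longrightarrow> - x \<in> K" "x \<in> K \<Longrightarrow> inverse x \<in> K"
    "x \<in> K \<Longrightarrow> y \<in> K \<Longrightarrow> x + y \<in> K" "x \<in> K \<Longrightarrow> y \<in> K \<Longrightarrow> x * y \<in> K"
    "0 \<in> K" "x \<in> K \<Longrightarrow> y \<in> K \<Longrightarrow> x / y \<in> K"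
proof -
  show *: "1 \<in> K" "x \<in> K \<Longrightarrow> - x \<in> K" "x \<in> K \<Longrightarrow> inverse x \<in> K"
    "x \<in> K \<Longrightarrow> y \<in> K \<Longrightarrow> x + y \<in> K" "x \<in> K \<Longrightarrow> y \<in> K \<Longrightarrow> x * y \<in> K" for x y
    using assms by (auto simp: real_subfield_def)
  show "0 \<in> K" using *(4)[OF *(1) *(2)[OF *(1)]] by simp
  show "x \<in> K \<Longrightarrow> y \<in> K \<Longrightarrow> x / y \<in> K"
    by (simp add: divide_inverse *)
qed

lemma real_subfield_of_rat:
  assumes "real_subfield K"
  shows "of_rat q \<in> K"
proof -
  note K = real_subfieldD[OF assms]
  have nat: "of_nat n \<in> K" for n
    by (induction n) (use K in auto)
  have int: "of_int i \<in> K" for i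
    using nat[of "nat i"] nat[of "nat (- i)"] K(2)[of "of_nat (nat (- i))"]
    by (cases "i \<ge> 0") auto
  obtain a b where "q = Rat.Fract a b" "b > 0" by (cases q)
  then show ?thesis
    using K(7)[OF int[of a] int[of b]] by (simp add: of_rat_rat)
qed

lemma real_subfield_fractions: "real_subfield (fractions g V)"
proof -
  let ?E = "eval_poly of_rat g"
  note hom = comm_ring_hom_eval_poly[OF comm_ring_hom_of_rat[where 'a = real]]
  \<comment> \<open>A vanishing denominator gives the value 0, which is also \<open>0 / 1\<close>.
    Membership can then be shown without checking denominators.\<close>
  have I: "?E p / ?E q \<in> fractions g V" if "p \<in> polys_over V" "q \<in> polys_over V" for p q
    using that polys_over_0[of V] polys_over_1[of V]
    by (cases "?E q = 0") (force simp: fractions_def hom_simps[OF hom])+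
  have one: "1 \<in> fractions g V"
    using I[OF polys_over_1 polys_over_1] by (simp add: hom_simps[OF hom])
  have un: "- x \<in> fractions g V" "inverse x \<in> fractions g V" if "x \<in> fractions g V" for x
  proof -
    obtain p q where "p \<in> polys_over V" "q \<in> polys_over V" "x = ?E p / ?E q"
      using \<open>x \<in> _\<close> by (auto simp: fractions_def)
    then show "- x \<in> fractions g V" "inverse x \<in> fractions g V"
      using I[of "- p" q] I[of q p] by (auto simp: hom_simps[OF hom] polys_over_uminus)
  qed
  have bin: "x + y \<in> fractions g V" "x * y \<in> fractions g V"
    if "x \<in> fractions g V" "y \<in> fractions g V" for x y
  proof -
    obtain p q where x: "p \<in> polys_over V" "q \<in> polys_over V" "x = ?E p / ?E q" "?E q \<noteq> 0"
      using \<open>x \<in> _\<close> by (auto simp: fractions_def)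
    obtain p' q' where y: "p' \<in> polys_over V" "q' \<in> polys_over V" "y = ?E p' / ?E q'" "?E q' \<noteq> 0"
      using \<open>y \<in> _\<close> by (auto simp: fractions_def)
    show "x + y \<in> fractions g V"
      using I[of "p * q' + p' * q" "q * q'"] x y
      by (simp add: polys_over_add polys_over_mult hom_simps[OF hom] add_frac_eq)
    show "x * y \<in> fractions g V"
      using I[of "p * p'" "q * q'"] x y
      by (simp add: polys_over_mult hom_simps[OF hom])
  qed
  show ?thesis
    using one un bin by (simp add: real_subfield_def)
qed

lemma fractions_gen: "v \<in> V \<Longrightarrow> g v \<in> fractions g V"
proof -
  assume "v \<in> V"
  note rat = comm_ring_hom_of_rat[where 'a = real]
  have "g v = eval_poly of_rat g (var_poly v) / eval_poly of_rat g 1"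
    by (simp add: eval_poly_var[OF rat] hom_simps[OF comm_ring_hom_eval_poly[OF rat]])
  moreover have "eval_poly of_rat g 1 \<noteq> (0 :: real)"
    by (simp add: hom_simps[OF comm_ring_hom_eval_poly[OF rat]])
  ultimately show ?thesis
    unfolding fractions_def using polys_over_var[OF \<open>v \<in> V\<close>] polys_over_1 by blast
qed

section \<open>Generated subfields in terms of real arithmetic\<close>

lemma rat_adjoin_simps:
  "x \<oplus>\<^bsub>rat_adjoin S\<^esub> y = x + y" "x \<otimes>\<^bsub>rat_adjoin S\<^esub> y = x * y"
  "\<zero>\<^bsub>rat_adjoin S\<^esub> = 0" "\<one>\<^bsub>rat_adjoin S\<^esub> = 1"
  by (simp_all add: rat_adjoin_def ring_of_type_algebra_def)

lemma carrier_rat_adjoin: "carrier (rat_adjoin S) = generate_field ring_of_type_algebra S"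
  by (simp add: rat_adjoin_def)

lemma ring_of_type_algebra_uminus: "\<ominus>\<^bsub>ring_of_type_algebra\<^esub> x = - (x :: real)"
  by (auto simp: a_inv_def m_inv_def ring_of_type_algebra_def intro!: the_equality)

lemma ring_of_type_algebra_inverse:
  "x \<noteq> 0 \<Longrightarrow> inv\<^bsub>ring_of_type_algebra\<^esub> x = inverse (x :: real)"
  unfolding m_inv_def by (rule the_equality) (auto simp: ring_of_type_algebra_def field_simps)

lemma real_subfield_rat_adjoin: "real_subfield (carrier (rat_adjoin S))"
proof -
  let ?R = "ring_of_type_algebra :: real ring" and ?K = "carrier (rat_adjoin S)"
  have R: "\<one>\<^bsub>?R\<^esub> = 1" "\<zero>\<^bsub>?R\<^esub> = 0" "x \<oplus>\<^bsub>?R\<^esub> y = x + y" "x \<otimes>\<^bsub>?R\<^esub> y = x * y" for x y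
    by (simp_all add: ring_of_type_algebra_def)
  note gen = generate_field.intros[where R = ?R, unfolded R ring_of_type_algebra_uminus,
      folded carrier_rat_adjoin]
  have "0 \<in> ?K" using gen(5)[OF gen(1) gen(3)[OF gen(1)]] by simp
  moreover have "inverse x \<in> ?K" if "x \<in> ?K" for x
    using gen(4)[OF that] ring_of_type_algebra_inverse[of x] \<open>0 \<in> ?K\<close> by (cases "x = 0") auto
  ultimately show ?thesis
    using gen by (simp add: real_subfield_def)
qed

lemma rat_adjoin_gen: "x \<in> S \<Longrightarrow> x \<in> carrier (rat_adjoin S)"
  by (simp add: carrier_rat_adjoin generate_field.incl)

text \<open>With \<open>fractions\<close> as the larger field, this presents every element of the
  generated field as a quotient of polynomial values.\<close>

lemma rat_adjoin_subset:
  assumes "real_subfield K" "S \<subseteq> K"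
  shows "carrier (rat_adjoin S) \<subseteq> K"
proof
  fix x assume "x \<in> carrier (rat_adjoin S)"
  then have "x \<in> generate_field ring_of_type_algebra S" by (simp add: carrier_rat_adjoin)
  then show "x \<in> K"
  proof induction
    case (m_inv h)
    then have "h \<noteq> 0" by (simp add: ring_of_type_algebra_def)
    then show ?case
      using m_inv real_subfieldD[OF assms(1)] by (simp add: ring_of_type_algebra_inverse)
  next
    case (a_inv h)
    then show ?case
      using real_subfieldD[OF assms(1)] by (simp add: ring_of_type_algebra_uminus)
  qed (use assms real_subfieldD[OF assms(1)] in \<open>auto simp: ring_of_type_algebra_def\<close>)
qed

text \<open>If \<open>x\<close> outside \<open>W\<close> were a quotient \<open>p / q\<close> over
  \<open>W\<close>, then \<open>var_poly x * q - p\<close> would be the zero polynomial by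
  independence. This cannot be, as \<open>x\<close> occurs in neither \<open>p\<close> nor
  \<open>q\<close>. The lemma later recovers \<open>D\<close> from the field generated by
  \<open>B\<close> and \<open>D\<close>.\<close>

lemma fractions_inter_subset:
  assumes indep: "alg_indep of_rat (\<lambda>x. x) V" and "W \<subseteq> V"
    and x: "x \<in> V" "x \<in> fractions (\<lambda>x. x) W"
  shows "x \<in> W"
proof (rule ccontr)
  assume "x \<notin> W"
  let ?E = "eval_poly of_rat :: _ \<Rightarrow> _ \<Rightarrow> real"
  note rat = comm_ring_hom_of_rat[where 'a = real]
  note hom = comm_ring_hom_eval_poly[OF rat]
  obtain p q where pq: "p \<in> polys_over W" "q \<in> polys_over W" "?E (\<lambda>x. x) q \<noteq> 0"
    "x = ?E (\<lambda>x. x) p / ?E (\<lambda>x. x) q"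
    using x(2) by (auto simp: fractions_def)
  define u where "u = var_poly x * q - p"
  have "p \<in> polys_over V" "q \<in> polys_over V"
    using pq \<open>W \<subseteq> V\<close> by (auto simp: polys_over_def)
  then have "u \<in> polys_over V"
    using x by (auto simp: u_def intro!: polys_over_diff polys_over_mult polys_over_var)
  moreover have "?E (\<lambda>x. x) u = 0"
    using pq by (simp add: u_def hom_simps[OF hom] eval_poly_var[OF rat] field_simps)
  ultimately have "u = 0" by (rule alg_indepD[OF indep])
  \<comment> \<open>The zero polynomial also vanishes after shifting the value of \<open>x\<close>
    alone; subtracting the two evaluations leaves the value of \<open>q\<close>, which is
    nonzero.\<close>
  then have "?E ((\<lambda>x. x)(x := x + 1)) u = 0" by (simp add: hom_simps[OF hom])
  moreover have "?E ((\<lambda>x. x)(x := x + 1)) s = ?E (\<lambda>x. x) s" if "s \<in> polys_over W" for s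
    using that \<open>x \<notin> W\<close> by (intro eval_poly_cong) (auto simp: polys_over_def)
  ultimately have "(x + 1) * ?E (\<lambda>x. x) q - ?E (\<lambda>x. x) p = 0"
    using pq by (simp add: u_def hom_simps[OF hom] eval_poly_var[OF rat])
  then show False using pq by (simp add: field_simps)
qed

section \<open>Embeddings, pulled-back orderings and realized cuts\<close>

text \<open>Only the restriction of \<open>h\<close> to \<open>K\<close> matters. Injectivity on a
  subfield is a consequence: a nonzero element has an inverse in \<open>K\<close>, so its image is
  nonzero.\<close>

definition field_embedding :: "real set \<Rightarrow> (real \<Rightarrow> 'b::field) \<Rightarrow> bool" where
  "field_embedding K h \<longleftrightarrow> h 1 = 1 \<and>
    (\<forall>x\<in>K. \<forall>y\<in>K. h (x + y) = h x + h y \<and> h (x * y) = h x * h y)"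

lemma field_embeddingD:
  assumes K: "real_subfield K" and h: "field_embedding K h"
  shows "h 1 = 1" "x \<in> K \<Longrightarrow> y \<in> K \<Longrightarrow> h (x + y) = h x + h y"
    "x \<in> K \<Longrightarrow> y \<in> K \<Longrightarrow> h (x * y) = h x * h y" "h 0 = 0"
    "x \<in> K \<Longrightarrow> h (- x) = - h x" "x \<in> K \<Longrightarrow> x \<noteq> 0 \<Longrightarrow> h x \<noteq> 0"
proof -
  note KD = real_subfieldD[OF K]
  show *: "h 1 = 1" "x \<in> K \<Longrightarrow> y \<in> K \<Longrightarrow> h (x + y) = h x + h y"
    "x \<in> K \<Longrightarrow> y \<in> K \<Longrightarrow> h (x * y) = h x * h y" for x y
    using h by (auto simp: field_embedding_def)
  have "h 0 + h 0 = h 0 + 0" using *(2)[OF KD(6) KD(6)] by simp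
  then show zero: "h 0 = 0" by (rule add_left_imp_eq)
  show "h (- x) = - h x" if "x \<in> K"
    using *(2)[of x "- x"] zero KD(2) that by (simp add: eq_neg_iff_add_eq_0 add.commute)
  show "h x \<noteq> 0" if "x \<in> K" "x \<noteq> 0"
    using *(3)[of x "inverse x"] *(1) KD(3) that by auto
qed

lemma field_embedding_eq_iff:
  assumes K: "real_subfield K" and h: "field_embedding K h" and "x \<in> K" "y \<in> K"
  shows "h x = h y \<longleftrightarrow> x = y"
proof -
  note KD = real_subfieldD[OF K] and hD = field_embeddingD[OF K h]
  have "h (x + - y) = h x - h y"
    using assms by (simp add: KD hD del: add_uminus_conv_diff)
  then show ?thesis
    using hD(6)[of "x + - y"] KD(4)[OF \<open>x \<in> K\<close> KD(2)[OF \<open>y \<in> K\<close>]] by auto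
qed

text \<open>The prime field is fixed by every embedding; hence rational cuts can be compared across
  embeddings and isomorphisms.\<close>

lemma field_embedding_of_rat:
  fixes h :: "real \<Rightarrow> 'b::field_char_0"
  assumes K: "real_subfield K" and h: "field_embedding K h"
  shows "h (of_rat q) = of_rat q"
proof -
  note hD = field_embeddingD[OF K h]
  have K_int: "of_int i \<in> K" for i
    using real_subfield_of_rat[OF K, of "of_int i"] by simp
  have K_nat: "of_nat n \<in> K" for n
    using K_int[of "int n"] by simp
  have nat: "h (of_nat n) = of_nat n" for n
    by (induction n) (simp_all add: hD K_nat real_subfieldD[OF K])
  have int: "h (of_int i) = of_int i" for i
    using nat[of "nat i"] nat[of "nat (- i)"] hD(5)[OF K_nat[of "nat (- i)"]]
    by (cases "i \<ge> 0") auto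
  obtain a b where q: "q = Rat.Fract a b" "b > 0" by (cases q)
  then have "h (of_rat q) * of_int b = of_int a"
    using hD(3)[OF real_subfield_of_rat[OF K, of q] K_int[of b]]
    by (simp add: of_rat_rat int)
  then show ?thesis using q by (simp add: of_rat_rat field_simps)
qed

text \<open>Independence makes both evaluations injective on polynomials over \<open>V\<close>, so
  sending a quotient of values under \<open>g\<close> to the same quotient under \<open>f\<close> is
  well defined by cross multiplication.\<close>

lemma field_embedding_extend:
  fixes c :: "rat \<Rightarrow> 'b::field"
  assumes c: "comm_ring_hom c" and g: "alg_indep of_rat g V" and f: "alg_indep c f V"
  shows "\<exists>h. field_embedding (fractions g V) h \<and>
    (\<forall>p\<in>polys_over V. \<forall>q\<in>polys_over V. q \<noteq> 0 \<longrightarrow>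
      h (eval_poly of_rat g p / eval_poly of_rat g q) = eval_poly c f p / eval_poly c f q)"
proof -
  let ?G = "eval_poly of_rat g" and ?F = "eval_poly c f"
  note G = comm_ring_hom_eval_poly[OF comm_ring_hom_of_rat[where 'a = real]]
    and F = comm_ring_hom_eval_poly[OF c]
  have G0: "?G p = 0 \<longleftrightarrow> p = 0" and F0: "?F p = 0 \<longleftrightarrow> p = 0" if "p \<in> polys_over V" for p
    using that g f by (auto simp: alg_indep_def hom_simps[OF G] hom_simps[OF F])
  have wd: "?F p / ?F q = ?F p' / ?F q'"
    if "p \<in> polys_over V" "q \<in> polys_over V" "p' \<in> polys_over V" "q' \<in> polys_over V"
      "q \<noteq> 0" "q' \<noteq> 0" "?G p / ?G q = ?G p' / ?G q'" for p q p' q'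
  proof -
    have "?G (p * q' - p' * q) = 0"
      using that by (simp add: hom_simps[OF G] G0 frac_eq_eq)
    then have "p * q' - p' * q = 0"
      using that by (subst (asm) G0) (auto intro!: polys_over_diff polys_over_mult)
    then have "?F (p * q' - p' * q) = 0" by (simp only: hom_simps[OF F])
    then show ?thesis
      using that by (simp add: hom_simps[OF F] F0 frac_eq_eq)
  qed
  have "\<forall>x\<in>fractions g V. \<exists>p q. p \<in> polys_over V \<and> q \<in> polys_over V \<and> q \<noteq> 0 \<and> x = ?G p / ?G q"
    by (fastforce simp: fractions_def G0)
  \<comment> \<open>One presentation is chosen for each element; by \<open>wd\<close> the resulting
    value does not depend on the choice.\<close>
  then obtain P Q where PQ: "\<And>x. x \<in> fractions g V \<Longrightarrow>
      P x \<in> polys_over V \<and> Q x \<in> polys_over V \<and> Q x \<noteq> 0 \<and> x = ?G (P x) / ?G (Q x)"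
    by metis
  define h where "h x = ?F (P x) / ?F (Q x)" for x
  have h: "h (?G p / ?G q) = ?F p / ?F q"
    if "p \<in> polys_over V" "q \<in> polys_over V" "q \<noteq> 0" for p q
  proof -
    have "?G p / ?G q \<in> fractions g V"
      using that G0[of q] unfolding fractions_def by blast
    from PQ[OF this] show ?thesis
      unfolding h_def by (intro wd) (use that in auto)
  qed
  have "h (x + y) = h x + h y" "h (x * y) = h x * h y"
    if "x \<in> fractions g V" "y \<in> fractions g V" for x y
  proof -
    define p q p' q' where pq: "p = P x" "q = Q x" "p' = P y" "q' = Q y"
    have in_V: "p \<in> polys_over V" "q \<in> polys_over V" "p' \<in> polys_over V" "q' \<in> polys_over V"
      and nz: "q \<noteq> 0" "q' \<noteq> 0" and xy: "x = ?G p / ?G q" "y = ?G p' / ?G q'"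
      unfolding pq using PQ that by blast+
    \<comment> \<open>That the common denominator is a nonzero polynomial is read off from its real
      value.\<close>
    have "?G (q * q') \<noteq> 0"
      using in_V nz by (simp add: hom_simps[OF G] G0)
    then have "q * q' \<noteq> 0" by (auto simp: hom_simps[OF G])
    then show "h (x + y) = h x + h y" "h (x * y) = h x * h y"
      using h[of "p * q' + p' * q" "q * q'"] h[of "p * p'" "q * q'"] h[of p q] h[of p' q'] in_V nz
      by (simp_all add: xy polys_over_add polys_over_mult hom_simps[OF G] hom_simps[OF F]
          G0 F0 add_frac_eq)
  qed
  moreover have "h 1 = 1"
    using h[OF polys_over_1 polys_over_1] by (simp add: hom_simps[OF G] hom_simps[OF F])
  ultimately have "field_embedding (fractions g V) h" by (simp add: field_embedding_def)
  then show ?thesis using h by blast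
qed

section \<open>Orderings induced by embeddings, and their invariant\<close>

definition pullback_ordering :: "real set \<Rightarrow> (real \<Rightarrow> 'b::linorder) \<Rightarrow> real rel" where
  "pullback_ordering K h = {(x, y). x \<in> K \<and> y \<in> K \<and> h x \<le> h y}"

text \<open>Antisymmetry is injectivity of the embedding; the other axioms transfer from the
  target.\<close>

lemma field_ordering_pullback:
  fixes h :: "real \<Rightarrow> 'b::linordered_field" and S :: "real set"
  defines "K \<equiv> carrier (rat_adjoin S)"
  assumes h: "field_embedding K h"
  shows "field_ordering (rat_adjoin S) (pullback_ordering K h)"
proof -
  have K: "real_subfield K" unfolding K_def by (rule real_subfield_rat_adjoin)
  note KD = real_subfieldD[OF K] and hD = field_embeddingD[OF K h]
  have "linear_order_on K (pullback_ordering K h)"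
    unfolding linear_order_on_def partial_order_on_def preorder_on_def
      refl_on_def trans_def antisym_def total_on_def pullback_ordering_def
    using field_embedding_eq_iff[OF K h] by auto
  then show ?thesis
    unfolding field_ordering_def rat_adjoin_simps K_def[symmetric]
    by (auto simp: pullback_ordering_def KD hD)
qed

lemma archimedean_pullback_iff:
  fixes h :: "real \<Rightarrow> 'b::linordered_field" and S :: "real set"
  defines "K \<equiv> carrier (rat_adjoin S)"
  assumes h: "field_embedding K h"
  shows "archimedean (rat_adjoin S) (pullback_ordering K h) \<longleftrightarrow> (\<forall>x\<in>K. \<exists>n::nat. h x \<le> of_nat n)"
proof -
  have K: "real_subfield K" unfolding K_def by (rule real_subfield_rat_adjoin)
  have pow: "[n] \<cdot>\<^bsub>rat_adjoin S\<^esub> \<one>\<^bsub>rat_adjoin S\<^esub> = real n" for n :: nat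
    by (induction n) (simp_all add: add_pow_def nat_pow_def rat_adjoin_simps)
  have "h (real n) = of_nat n" for n
    using field_embedding_of_rat[OF K h, of "of_nat n"] by simp
  moreover have "real n \<in> K" for n
    using real_subfield_of_rat[OF K, of "of_nat n"] by simp
  ultimately show ?thesis
    unfolding archimedean_def K_def[symmetric] pow by (simp add: pullback_ordering_def)
qed

text \<open>
  For an archimedean ordering these are the images of the elements in \<open>\<real>\<close>; in general they
  form the residue field of the ordering.
\<close>

definition realized_cuts :: "real set \<Rightarrow> real rel \<Rightarrow> real set" where
  "realized_cuts K r = {y. \<exists>x\<in>K. \<forall>q. (of_rat q < y \<longrightarrow> (of_rat q, x) \<in> r) \<and>
    (y < of_rat q \<longrightarrow> (x, of_rat q) \<in> r)}"

lemma realized_cuts_pullback: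
  fixes h :: "real \<Rightarrow> 'b::linordered_field"
  assumes K: "real_subfield K" and h: "field_embedding K h"
  shows "realized_cuts K (pullback_ordering K h) =
    {y. \<exists>x\<in>K. \<forall>q. (of_rat q < y \<longrightarrow> of_rat q \<le> h x) \<and> (y < of_rat q \<longrightarrow> h x \<le> of_rat q)}"
  unfolding realized_cuts_def pullback_ordering_def
  by (auto simp: real_subfield_of_rat[OF K] field_embedding_of_rat[OF K h])

text \<open>An isomorphism fixes the rationals and permutes \<open>K\<close>, so \<open>x\<close>
  and its image realize the same cuts.\<close>

lemma isomorphic_orderings_realized_cuts:
  fixes S :: "real set"
  defines "K \<equiv> carrier (rat_adjoin S)"
  assumes "isomorphic_orderings (rat_adjoin S) r s"
  shows "realized_cuts K r = realized_cuts K s"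
proof -
  have K: "real_subfield K" unfolding K_def by (rule real_subfield_rat_adjoin)
  obtain \<rho> where \<rho>: "\<rho> \<in> ring_iso (rat_adjoin S) (rat_adjoin S)"
    and iff: "\<And>x y. x \<in> K \<Longrightarrow> y \<in> K \<Longrightarrow> (x, y) \<in> r \<longleftrightarrow> (\<rho> x, \<rho> y) \<in> s"
    using assms by (auto simp: isomorphic_orderings_def)
  have "field_embedding K \<rho>"
    using \<rho> by (auto simp: ring_iso_def ring_hom_def rat_adjoin_simps K_def field_embedding_def)
  then have rat: "\<rho> (of_rat q) = of_rat q" for q
    by (rule field_embedding_of_rat[OF K])
  have bij: "\<rho> ` K = K"
    using \<rho> by (auto simp: ring_iso_def bij_betw_def K_def)
  have "(of_rat q, x) \<in> r \<longleftrightarrow> (of_rat q, \<rho> x) \<in> s" "(x, of_rat q) \<in> r \<longleftrightarrow> (\<rho> x, of_rat q) \<in> s"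
    if "x \<in> K" for x q
    using iff[OF real_subfield_of_rat[OF K] that] iff[OF that real_subfield_of_rat[OF K]]
    by (simp_all add: rat)
  then have "realized_cuts K r = {y. \<exists>x\<in>K. \<forall>q. (of_rat q < y \<longrightarrow> (of_rat q, \<rho> x) \<in> s) \<and>
      (y < of_rat q \<longrightarrow> (\<rho> x, of_rat q) \<in> s)}"
    unfolding realized_cuts_def by auto
  also have "\<dots> = {y. \<exists>x\<in>\<rho> ` K. \<forall>q. (of_rat q < y \<longrightarrow> (of_rat q, x) \<in> s) \<and>
      (y < of_rat q \<longrightarrow> (x, of_rat q) \<in> s)}"
    by simp
  finally show ?thesis by (simp add: bij realized_cuts_def)
qed

section \<open>Archimedean orderings from embeddings into the reals\<close>

lemma real_eqI_of_rat:
  fixes x y :: real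
  assumes "\<And>q. of_rat q < y \<Longrightarrow> of_rat q \<le> x" "\<And>q. y < of_rat q \<Longrightarrow> x \<le> of_rat q"
  shows "x = y"
proof (rule antisym)
  show "x \<le> y"
  proof (rule ccontr)
    assume "\<not> x \<le> y"
    then obtain q where "y < of_rat q" "of_rat q < x" using of_rat_dense[of y x] by auto
    then show False using assms(2)[of q] by simp
  qed
  show "y \<le> x"
  proof (rule ccontr)
    assume "\<not> y \<le> x"
    then obtain q where "x < of_rat q" "of_rat q < y" using of_rat_dense[of x y] by auto
    then show False using assms(1)[of q] by simp
  qed
qed

text \<open>Renaming variables along \<open>\<phi>\<close> turns a relation among the values of
  \<open>\<phi>\<close> into one among elements of \<open>V\<close>. The renamed polynomial is
  therefore zero, and the inverse renaming gives \<open>p\<close> back.\<close>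

lemma alg_indep_inj_reindex:
  assumes V: "alg_indep c (\<lambda>x. x) V" and c: "comm_ring_hom c"
    and \<phi>: "inj_on \<phi> V" "\<phi> ` V \<subseteq> V"
  shows "alg_indep c \<phi> V"
  unfolding alg_indep_def
proof (intro ballI impI)
  fix p assume p: "p \<in> polys_over V" "eval_poly c \<phi> p = 0"
  let ?C = "eval_poly const_poly"
  define p' where "p' = ?C (\<lambda>x. var_poly (\<phi> x)) p"
  have "p' \<in> polys_over V"
    unfolding p'_def using \<phi>(2) p(1) by (intro polys_over_eval[of _ V]) (auto intro: polys_over_var)
  moreover have "eval_poly c (\<lambda>x. x) p' = 0"
    using p(2) by (simp add: p'_def eval_poly_eval_poly[OF c] eval_poly_var[OF c])
  ultimately have "p' = 0" by (rule alg_indepD[OF V])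
  then have "?C (\<lambda>x. var_poly (inv_into V \<phi> x)) p' = 0"
    by (simp add: hom_simps[OF comm_ring_hom_eval_poly[OF comm_ring_hom_const_poly]])
  then have "?C (\<lambda>x. var_poly (inv_into V \<phi> (\<phi> x))) p = 0"
    by (simp add: p'_def eval_poly_eval_poly comm_ring_hom_const_poly eval_poly_var)
  then show "p = 0"
    by (subst (asm) eval_poly_self_cong[OF p(1)]) (simp_all add: inv_into_f_f \<phi>(1))
qed

lemma eval_poly_in_fractions:
  assumes "p \<in> polys_over V" "\<phi> ` V \<subseteq> W"
  shows "eval_poly of_rat \<phi> p \<in> fractions (\<lambda>x. x) W"
  using assms
  by (intro eval_poly_in_subring)
     (auto simp: polys_over_def[of V] real_subfield_of_rat real_subfield_fractions
       intro: real_subfieldD[OF real_subfield_fractions] fractions_gen[where g = "\<lambda>x. x"])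

lemma field_embedding_mono: "field_embedding K h \<Longrightarrow> K' \<subseteq> K \<Longrightarrow> field_embedding K' h"
  unfolding field_embedding_def by blast

text \<open>Sending each generator \<open>g v\<close> to \<open>\<phi> v\<close> extends to an
  embedding of \<open>K\<close> into the reals. The order pulled back along it is archimedean and
  its realized cuts are the image of \<open>K\<close>.\<close>

lemma archimedean_ordering_exists:
  fixes V :: "real set" and g :: "real \<Rightarrow> real"
  defines "K \<equiv> rat_adjoin (g ` V)"
  assumes g: "alg_indep of_rat g V" and V: "alg_indep of_rat (\<lambda>x. x) V"
    and \<phi>: "inj_on \<phi> V" "\<phi> ` V \<subseteq> V"
  shows "\<exists>r. field_ordering K r \<and> archimedean K r \<and>
    \<phi> ` V \<subseteq> realized_cuts (carrier K) r \<and>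
    realized_cuts (carrier K) r \<subseteq> fractions (\<lambda>x. x) (\<phi> ` V)"
proof -
  note rat = comm_ring_hom_of_rat[where 'a = real]
  note hom = comm_ring_hom_eval_poly[OF rat]
  from field_embedding_extend[OF rat g alg_indep_inj_reindex[OF V rat \<phi>]]
  obtain h where h: "field_embedding (fractions g V) h"
    and h_eq: "\<forall>p\<in>polys_over V. \<forall>q\<in>polys_over V. q \<noteq> 0 \<longrightarrow>
      h (eval_poly of_rat g p / eval_poly of_rat g q) = eval_poly of_rat \<phi> p / eval_poly of_rat \<phi> q"
    by (elim exE conjE)
  have K: "real_subfield (carrier K)" "carrier K \<subseteq> fractions g V"
    unfolding K_def
    by (rule real_subfield_rat_adjoin, rule rat_adjoin_subset[OF real_subfield_fractions])
       (auto intro: fractions_gen)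
  then have hK: "field_embedding (carrier K) h" using field_embedding_mono[OF h] by blast
  let ?r = "pullback_ordering (carrier K) h"
  have "field_ordering K ?r" "archimedean K ?r"
    using field_ordering_pullback[of "g ` V" h] archimedean_pullback_iff[of "g ` V" h] hK
    by (simp_all add: K_def real_arch_simple)
  moreover have cuts: "realized_cuts (carrier K) ?r = h ` carrier K"
  proof -
    \<comment> \<open>A real number realizes no cut but its own, by density of the
      rationals.\<close>
    have "(\<forall>q. (of_rat q < y \<longrightarrow> of_rat q \<le> h x) \<and> (y < of_rat q \<longrightarrow> h x \<le> of_rat q)) \<longleftrightarrow> h x = y" for x y
      using real_eqI_of_rat[of y "h x"] by (metis less_imp_le)
    then show ?thesis by (subst realized_cuts_pullback[OF K(1) hK]) (simp, blast)
  qed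
  moreover have "h x \<in> fractions (\<lambda>x. x) (\<phi> ` V)" if "x \<in> carrier K" for x
  proof -
    obtain p q where "p \<in> polys_over V" "q \<in> polys_over V" "eval_poly of_rat g q \<noteq> 0"
      "x = eval_poly of_rat g p / eval_poly of_rat g q"
      using K(2) \<open>x \<in> _\<close> by (fastforce simp: fractions_def)
    moreover from this have "q \<noteq> 0" by (auto simp: hom_simps[OF hom])
    ultimately show ?thesis
      using h_eq[rule_format, of p q] eval_poly_in_fractions[of _ V \<phi> "\<phi> ` V"]
      by (auto intro!: real_subfieldD(7)[OF real_subfield_fractions])
  qed
  moreover have "\<phi> v \<in> h ` carrier K" if "v \<in> V" for v
  proof -
    have "h (g v) = \<phi> v"
      using h_eq[rule_format, OF polys_over_var[OF that] polys_over_1]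
      by (simp add: eval_poly_var[OF rat] hom_simps[OF hom])
    moreover have "g v \<in> carrier K" using that by (auto simp: K_def intro: rat_adjoin_gen)
    ultimately show ?thesis by (metis imageI)
  qed
  ultimately show ?thesis by (intro exI[of _ ?r]) auto
qed

section \<open>Orderings from rational functions\<close>

text \<open>This identifies the rational constants among the rational functions with
  \<open>of_rat\<close>, so that comparisons with rationals become comparisons of
  polynomials.\<close>

lemma comm_ring_hom_rat_unique:
  fixes c :: "rat \<Rightarrow> 'a::field_char_0"
  assumes "comm_ring_hom c"
  shows "c q = of_rat q"
proof -
  note c = hom_simps[OF assms]
  have nat: "c (of_nat n) = of_nat n" for n
    by (induction n) (simp_all add: c)
  have int: "c (of_int i) = of_int i" for i
    using nat[of "nat i"] nat[of "nat (- i)"] comm_ring_hom.hom_uminus[OF assms, of "of_nat (nat (- i))"]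
    by (cases "i \<ge> 0") auto
  obtain a b where q: "q = Rat.Fract a b" "b > 0" by (cases q)
  then have "c q * of_int b = of_int a"
    using comm_ring_hom.hom_mult[OF assms, of q "of_int b"] by (simp add: int Fract_of_int_quotient)
  then show ?thesis using q by (simp add: of_rat_rat field_simps)
qed

definition to_ratfun :: "real Polynomial.poly \<Rightarrow> real Polynomial.poly fract" where
  "to_ratfun p = Fraction_Field.Fract p 1"

lemma comm_ring_hom_to_ratfun: "comm_ring_hom to_ratfun"
  by unfold_locales (simp_all add: to_ratfun_def One_fract_def)

lemma comm_ring_hom_real_const: "comm_ring_hom (\<lambda>a. [:of_rat a:] :: real Polynomial.poly)"
  by unfold_locales (simp_all add: of_rat_add of_rat_mult one_pCons)

lemma of_rat_ratfun: "of_rat a = Fraction_Field.Fract [:of_rat a:] (1 :: real Polynomial.poly)"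
  using comm_ring_hom_rat_unique[OF comm_ring_hom_comp[OF comm_ring_hom_to_ratfun
      comm_ring_hom_real_const]]
  by (simp add: to_ratfun_def)

text \<open>The order on polynomials is governed by the leading coefficient, which makes the
  indeterminate larger than every real number.\<close>

lemma real_poly_nonneg_iff:
  "0 \<le> (p :: real Polynomial.poly) \<longleftrightarrow> 0 \<le> Polynomial.lead_coeff p"
  by (auto simp: less_eq_poly_def pos_poly_def less_le)

text \<open>The cut of a rational function is that of its limit at infinity. Lying between rationals
  forces the degree of \<open>P\<close> to be at most that of \<open>Q\<close>, and the limit is
  then the quotient of the coefficients in the degree of \<open>Q\<close>; it is 0 if
  \<open>P\<close> has smaller degree.\<close>

lemma ratfun_cut_eq_coeff_quotient:
  fixes P Q :: "real Polynomial.poly"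
  assumes "Q \<noteq> 0"
    and lower: "\<And>a. of_rat a < y \<Longrightarrow> of_rat a \<le> Fraction_Field.Fract P Q"
    and upper: "\<And>a. y < of_rat a \<Longrightarrow> Fraction_Field.Fract P Q \<le> of_rat a"
  shows "y = Polynomial.coeff P (Polynomial.degree Q) / Polynomial.lead_coeff Q"
proof -
  define n where "n = Polynomial.degree Q"
  define l where "l = Polynomial.lead_coeff Q"
  have l: "l \<noteq> 0" using \<open>Q \<noteq> 0\<close> by (simp add: l_def)
  let ?D = "\<lambda>a. P - [:of_rat a:] * Q"
  \<comment> \<open>Comparing \<open>P / Q\<close> with a rational amounts to the sign of
    \<open>?D a * Q\<close>, since the square of \<open>Q\<close> is positive; the leading
    coefficients decide this sign.\<close>
  have lower': "0 \<le> Polynomial.lead_coeff (?D a) * l" if "of_rat a < y" for a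
  proof -
    have "0 \<le> ?D a * Q"
      using lower[OF that] \<open>Q \<noteq> 0\<close> by (simp add: of_rat_ratfun algebra_simps)
    then show ?thesis by (simp add: real_poly_nonneg_iff lead_coeff_mult l_def)
  qed
  have upper': "Polynomial.lead_coeff (?D a) * l \<le> 0" if "y < of_rat a" for a
  proof -
    have "0 \<le> - (?D a * Q)"
      using upper[OF that] \<open>Q \<noteq> 0\<close> by (simp add: of_rat_ratfun algebra_simps)
    then have "0 \<le> Polynomial.lead_coeff (- (?D a * Q))" by (simp only: real_poly_nonneg_iff)
    then show ?thesis by (simp add: lead_coeff_mult l_def)
  qed
  obtain a b :: rat where ab: "of_rat a < y" "y < of_rat b"
    using of_rat_dense[of "y - 1" y] of_rat_dense[of y "y + 1"] by auto
  have deg: "Polynomial.degree P \<le> n"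
  proof (rule ccontr)
    assume "\<not> Polynomial.degree P \<le> n"
    then have less: "Polynomial.degree Q < Polynomial.degree P" by (simp add: n_def)
    \<comment> \<open>If \<open>P\<close> had larger degree, subtracting a rational multiple of
      \<open>Q\<close> would not affect its leading term. The sign would be the same below and above
      \<open>y\<close>.\<close>
    have "Polynomial.lead_coeff (?D a) = Polynomial.lead_coeff P" for a
    proof -
      have "Polynomial.degree (- ([:of_rat a:] * Q)) < Polynomial.degree P"
        using less by simp
      from degree_add_eq_left[OF this] show ?thesis
        using less by (simp add: coeff_eq_0)
    qed
    then have "Polynomial.lead_coeff P * l = 0"
      using lower'[OF ab(1)] upper'[OF ab(2)] by simp
    then show False using l less by auto
  qed
  define z where "z = Polynomial.coeff P n / l"
  \<comment> \<open>When \<open>z\<close> equals the rational, the coefficient in degree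
    \<open>n\<close> cancels and need not be the leading one; that case is excluded here and trivial
    below.\<close>
  have lead: "Polynomial.lead_coeff (?D a) = l * (z - of_rat a)" if "of_rat a \<noteq> z" for a
  proof -
    have c: "Polynomial.coeff (?D a) n = l * (z - of_rat a)"
      using l by (simp add: z_def l_def n_def algebra_simps)
    have "Polynomial.degree (?D a) \<le> n"
      using deg by (intro degree_diff_le) (auto simp: n_def)
    moreover have "n \<le> Polynomial.degree (?D a)"
      using c that l by (intro le_degree) simp
    ultimately show ?thesis using c by simp
  qed
  have ll: "0 < l * l" using l not_real_square_gt_zero by blast
  have "z = y"
  proof (rule real_eqI_of_rat)
    fix a assume "of_rat a < y"
    from lower'[OF this] lead[of a] have "of_rat a \<noteq> z \<Longrightarrow> 0 \<le> (l * l) * (z - of_rat a)"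
      by (simp add: mult_ac)
    then show "of_rat a \<le> z" using ll by (cases "of_rat a = z") (auto simp: zero_le_mult_iff)
  next
    fix a assume "y < of_rat a"
    from upper'[OF this] lead[of a] have "of_rat a \<noteq> z \<Longrightarrow> (l * l) * (z - of_rat a) \<le> 0"
      by (simp add: mult_ac)
    then show "z \<le> of_rat a"
      using ll by (cases "of_rat a = z") (auto simp: mult_le_0_iff)
  qed
  then show ?thesis by (simp add: z_def n_def l_def)
qed

text \<open>The generator at \<open>t\<close> goes to the indeterminate and every other
  \<open>g v\<close> to the constant \<open>\<phi> v\<close>. Only the constants are visible in the
  realized cuts, so these lie in the field generated by the image of \<open>V - {t}\<close>.\<close>

lemma nonarchimedean_ordering_exists:
  fixes V :: "real set" and g :: "real \<Rightarrow> real"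
  defines "K \<equiv> rat_adjoin (g ` V)"
  assumes g: "alg_indep of_rat g V" and V: "alg_indep of_rat (\<lambda>x. x) V"
    and \<phi>: "inj_on \<phi> V" "\<phi> ` V \<subseteq> V" and t: "t \<in> V"
  shows "\<exists>r. field_ordering K r \<and> \<not> archimedean K r \<and>
    \<phi> ` (V - {t}) \<subseteq> realized_cuts (carrier K) r \<and>
    realized_cuts (carrier K) r \<subseteq> fractions (\<lambda>x. x) (\<phi> ` (V - {t}))"
proof -
  note rat = comm_ring_hom_of_rat[where 'a = real]
  define c :: "rat \<Rightarrow> real Polynomial.poly" where "c = (\<lambda>a. [:of_rat a:])"
  define f where "f = (\<lambda>v. [:\<phi> v:])(t := [:0, 1:])"
  define E where "E = eval_poly c f"
  define c' where "c' a = to_ratfun (c a)" for a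
  define f' where "f' v = to_ratfun (f v)" for v
  have c: "comm_ring_hom c" unfolding c_def by (rule comm_ring_hom_real_const)
  note E = comm_ring_hom_eval_poly[OF c, of f, folded E_def]
  have c': "comm_ring_hom c'"
    unfolding c'_def by (rule comm_ring_hom_comp[OF comm_ring_hom_to_ratfun c])
  have E': "eval_poly c' f' p = to_ratfun (E p)" for p
    unfolding E_def hom_eval_poly[OF c comm_ring_hom_to_ratfun] c'_def f'_def ..
  \<comment> \<open>Specializing the indeterminate to \<open>\<phi> t\<close> restores the real
    family \<open>\<phi>\<close>, whose independence therefore passes to \<open>f\<close>.\<close>
  have E_eval: "Polynomial.poly (E p) (\<phi> t) = eval_poly of_rat \<phi> p" for p
  proof -
    have "comm_ring_hom (\<lambda>P. Polynomial.poly P (\<phi> t))"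
      by unfold_locales simp_all
    moreover have "(\<lambda>v. Polynomial.poly (f v) (\<phi> t)) = \<phi>" by (auto simp: f_def)
    ultimately show ?thesis
      unfolding E_def by (subst hom_eval_poly[OF c]) (simp_all add: c_def)
  qed
  have E0: "p = 0" if "p \<in> polys_over V" "E p = 0" for p
    using alg_indepD[OF alg_indep_inj_reindex[OF V rat \<phi>] that(1)] E_eval[of p] that(2) by simp
  have "alg_indep c' f' V"
    by (auto simp: alg_indep_def E' to_ratfun_def Zero_fract_def eq_fract intro: E0)
  from field_embedding_extend[OF c' g this]
  obtain h where h: "field_embedding (fractions g V) h"
    and h_eq: "\<forall>p\<in>polys_over V. \<forall>q\<in>polys_over V. q \<noteq> 0 \<longrightarrow>
      h (eval_poly of_rat g p / eval_poly of_rat g q) = eval_poly c' f' p / eval_poly c' f' q"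
    by (elim exE conjE)
  have K: "real_subfield (carrier K)" "carrier K \<subseteq> fractions g V"
    unfolding K_def
    by (rule real_subfield_rat_adjoin, rule rat_adjoin_subset[OF real_subfield_fractions])
       (auto intro: fractions_gen)
  then have hK: "field_embedding (carrier K) h" using field_embedding_mono[OF h] by blast
  have gK: "g v \<in> carrier K" if "v \<in> V" for v
    using that by (auto simp: K_def intro: rat_adjoin_gen)
  have h_gen: "h (g v) = f' v" if "v \<in> V" for v
    using h_eq[rule_format, OF polys_over_var[OF that] polys_over_1]
    by (simp add: eval_poly_var[OF rat] eval_poly_var[OF c']
        hom_simps[OF comm_ring_hom_eval_poly[OF rat]] hom_simps[OF comm_ring_hom_eval_poly[OF c']])
  let ?r = "pullback_ordering (carrier K) h" and ?M = "fractions (\<lambda>x. x) (\<phi> ` (V - {t}))"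
  \<comment> \<open>The image of \<open>g t\<close> is the indeterminate, and subtracting it from
    any natural number leaves leading coefficient -1.\<close>
  have "\<not> h (g t) \<le> of_nat n" for n
  proof
    assume "h (g t) \<le> of_nat n"
    then have "to_ratfun [:0, 1:] \<le> of_rat (of_nat n)"
      by (simp add: h_gen[OF t] f'_def f_def)
    then have "[:0, 1:] \<le> [:real n:]"
      by (simp add: to_ratfun_def of_rat_ratfun del: of_rat_of_nat_eq) simp
    then have "0 \<le> [:real n:] - [:0, 1:]" by (simp only: diff_ge_0_iff_ge)
    then show False by (simp add: real_poly_nonneg_iff)
  qed
  then have order: "field_ordering K ?r" "\<not> archimedean K ?r"
    using field_ordering_pullback[of "g ` V" h] archimedean_pullback_iff[of "g ` V" h] hK gK[OF t]
    by (auto simp: K_def)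
  note cuts = realized_cuts_pullback[OF K(1) hK]
  have sub: "\<phi> v \<in> realized_cuts (carrier K) ?r" if "v \<in> V - {t}" for v
  proof -
    have "h (g v) = to_ratfun [:\<phi> v:]" using h_gen[of v] that by (simp add: f'_def f_def)
    then have "(of_rat q < \<phi> v \<longrightarrow> of_rat q \<le> h (g v)) \<and> (\<phi> v < of_rat q \<longrightarrow> h (g v) \<le> of_rat q)" for q
      by (simp add: to_ratfun_def of_rat_ratfun less_eq_poly_def pos_poly_def)
    then show ?thesis unfolding cuts using gK[of v] that by blast
  qed
  \<comment> \<open>Polynomials with all coefficients in the subfield \<open>?M\<close> form a ring
    that contains the indeterminate and the constants \<open>\<phi> v\<close> for \<open>v\<close>
    other than \<open>t\<close>.\<close>
  have coeffs: "Polynomial.coeff (E p) i \<in> ?M" if "p \<in> polys_over V" for p i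
  proof -
    note M = real_subfieldD[OF real_subfield_fractions[of "\<lambda>x. x" "\<phi> ` (V - {t})"]]
    have sum: "sum u {..k} \<in> ?M" if "\<And>j. u j \<in> ?M" for u and k :: nat
      by (induction k) (use that M in auto)
    have "E p \<in> {P. \<forall>i. Polynomial.coeff P i \<in> ?M}"
      unfolding E_def
    proof (rule eval_poly_in_subring)
      show "f x \<in> {P. \<forall>i. Polynomial.coeff P i \<in> ?M}" if "x \<in> poly_variables p" for x
        using that \<open>p \<in> polys_over V\<close> M fractions_gen[of "\<phi> x" "\<phi> ` (V - {t})" "\<lambda>x. x"]
        by (auto simp: f_def coeff_pCons polys_over_def split: nat.split)
      show "x * y \<in> {P. \<forall>i. Polynomial.coeff P i \<in> ?M}"
        if "x \<in> {P. \<forall>i. Polynomial.coeff P i \<in> ?M}" "y \<in> {P. \<forall>i. Polynomial.coeff P i \<in> ?M}" for x y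
        using that by (auto simp: coeff_mult intro!: sum M)
    qed (auto simp: c_def coeff_pCons M real_subfield_of_rat[OF real_subfield_fractions]
        coeff_1 split: nat.split)
    then show ?thesis by simp
  qed
  have "y \<in> ?M" if "y \<in> realized_cuts (carrier K) ?r" for y
  proof -
    obtain x where x: "x \<in> carrier K" "\<And>q. of_rat q < y \<Longrightarrow> of_rat q \<le> h x"
      "\<And>q. y < of_rat q \<Longrightarrow> h x \<le> of_rat q"
      using \<open>y \<in> _\<close> unfolding cuts by blast
    obtain p q where pq: "p \<in> polys_over V" "q \<in> polys_over V" "eval_poly of_rat g q \<noteq> 0"
      "x = eval_poly of_rat g p / eval_poly of_rat g q"
      using K(2) x(1) by (fastforce simp: fractions_def)
    then have "q \<noteq> 0" by (auto simp: hom_simps[OF comm_ring_hom_eval_poly[OF rat]])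
    then have "E q \<noteq> 0" using E0 pq by blast
    have "h x = Fraction_Field.Fract (E p) (E q)"
      using h_eq[rule_format, of p q] pq \<open>q \<noteq> 0\<close> by (simp add: E' to_ratfun_def)
    with x have "y = Polynomial.coeff (E p) (Polynomial.degree (E q)) / Polynomial.lead_coeff (E q)"
      by (intro ratfun_cut_eq_coeff_quotient \<open>E q \<noteq> 0\<close>) simp_all
    then show ?thesis
      using coeffs pq by (auto intro: real_subfieldD(7)[OF real_subfield_fractions])
  qed
  then show ?thesis using order sub by (intro exI[of _ ?r]) auto
qed

section \<open>Counting orderings\<close>

text \<open>Two disjoint copies of the continuum have the size of one; a bijection from the disjoint
  sum carries its two summands to \<open>B\<close> and \<open>C\<close>.\<close>

lemma eqpoll_UNIV_real_split:
  assumes "(A :: 'a set) \<approx> (UNIV :: real set)"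
  obtains B C where "B \<subseteq> A" "C \<subseteq> A" "B \<inter> C = {}" "B \<approx> (UNIV :: real set)" "C \<approx> (UNIV :: real set)"
proof -
  have "(UNIV :: real set) <+> (UNIV :: real set) \<approx> (UNIV :: real set)"
    unfolding eqpoll_iff_card_of_ordIso
    by (rule card_of_Plus_infinite1) (auto simp: infinite_UNIV_char_0 intro: card_of_mono1)
  then have "(UNIV :: real set) <+> (UNIV :: real set) \<approx> A"
    using assms eqpoll_sym eqpoll_trans by blast
  then obtain f where f: "inj_on f ((UNIV :: real set) <+> (UNIV :: real set))"
    "f ` ((UNIV :: real set) <+> (UNIV :: real set)) = A"
    unfolding eqpoll_def bij_betw_def by blast
  show ?thesis
  proof (rule that)
    show "f ` range Inl \<subseteq> A" "f ` range Inr \<subseteq> A" using f(2) by auto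
    show "f ` range Inl \<inter> f ` range Inr = {}" using f(1) by (auto dest: inj_onD)
    have "inj_on f (range Inl)" "inj_on f (range Inr)"
      by (rule inj_on_subset[OF f(1)], blast)+
    then have "f ` range Inl \<approx> range (Inl :: real \<Rightarrow> real + real)"
      "f ` range Inr \<approx> range (Inr :: real \<Rightarrow> real + real)"
      by (auto intro: inj_on_image_eqpoll_self)
    moreover have "range (Inl :: real \<Rightarrow> real + real) \<approx> (UNIV :: real set)"
      "range (Inr :: real \<Rightarrow> real + real) \<approx> (UNIV :: real set)"
      by (auto intro: inj_on_image_eqpoll_self)
    ultimately show "f ` range Inl \<approx> (UNIV :: real set)" "f ` range Inr \<approx> (UNIV :: real set)"
      by (blast intro: eqpoll_trans)+
  qed
qed

text \<open>The realized cuts are an isomorphism invariant from which \<open>D\<close> can be read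
  off. Choosing one ordering for each subset of \<open>C\<close> is thus injective, and distinct
  choices are not isomorphic.\<close>

lemma pairwise_nonisomorphic_family:
  assumes C: "C \<approx> (UNIV :: real set)" and K: "K = rat_adjoin S"
    and ex: "\<And>D. D \<subseteq> C \<Longrightarrow> \<exists>r. P r \<and> realized_cuts (carrier K) r \<inter> C = D"
  shows "\<exists>S. S \<approx> Pow (UNIV :: real set) \<and> (\<forall>r\<in>S. P r) \<and>
    pairwise (\<lambda>r s. \<not> isomorphic_orderings K r s) S"
proof -
  have "\<forall>D. \<exists>r. D \<subseteq> C \<longrightarrow> P r \<and> realized_cuts (carrier K) r \<inter> C = D" using ex by blast
  then have "\<exists>R. \<forall>D. D \<subseteq> C \<longrightarrow> P (R D) \<and> realized_cuts (carrier K) (R D) \<inter> C = D"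
    by (rule choice)
  then obtain R where
    R_all: "\<forall>D. D \<subseteq> C \<longrightarrow> P (R D) \<and> realized_cuts (carrier K) (R D) \<inter> C = D"
    by (rule exE)
  have R: "P (R D)" "realized_cuts (carrier K) (R D) \<inter> C = D" if "D \<subseteq> C" for D
    using R_all[rule_format, OF that] by (rule conjunct1, rule conjunct2)
  have "inj_on R (Pow C)"
  proof (rule inj_onI)
    fix D D' assume "D \<in> Pow C" "D' \<in> Pow C" "R D = R D'"
    then show "D = D'" using R(2)[of D] R(2)[of D'] by (metis PowD)
  qed
  then have "R ` Pow C \<approx> Pow C" by (rule inj_on_image_eqpoll_self)
  also have "Pow C \<approx> Pow (UNIV :: real set)"
  proof -
    obtain f where "bij_betw f C (UNIV :: real set)" using C unfolding eqpoll_def by (rule exE)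
    then show ?thesis unfolding eqpoll_def by (intro exI) (rule bij_betw_Pow)
  qed
  finally have "R ` Pow C \<approx> Pow (UNIV :: real set)" .
  moreover have "pairwise (\<lambda>r s. \<not> isomorphic_orderings K r s) (R ` Pow C)"
  proof (rule pairwiseI, elim imageE, clarsimp)
    fix D D'
    assume D: "D \<subseteq> C" "D' \<subseteq> C" "R D \<noteq> R D'" "isomorphic_orderings K (R D) (R D')"
    then have "realized_cuts (carrier K) (R D) = realized_cuts (carrier K) (R D')"
      unfolding K by (intro isomorphic_orderings_realized_cuts)
    then have "D = D'" using R(2)[OF D(1)] R(2)[OF D(2)] by metis
    then show False using D(3) by simp
  qed
  moreover have "\<forall>r\<in>R ` Pow C. P r" using R(1) by auto
  ultimately show ?thesis by (intro exI[of _ "R ` Pow C"] conjI)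
qed

theorem mainTheorem3:
  fixes A A' :: "real set" and K :: "real ring"
  assumes "A \<inter> A' = {}"
    and "A \<approx> (UNIV :: real set)" and "A' \<approx> (UNIV :: real set)"
    and "inner_measure A = 0" and "inner_measure A' = 0"
    and "inner_measure (UNIV - A) = 0" and "inner_measure (UNIV - A') = 0"
    and "algebraically_independent_over_rat (A \<union> A')"
    and "K = rat_adjoin ({sqrt a | a. a \<in> A \<and> a \<ge> 0} \<union> A')"
  shows "(\<exists>S :: real rel set. S \<approx> Pow (UNIV :: real set) \<and>
            (\<forall>r \<in> S. field_ordering K r \<and> archimedean K r) \<and>
            pairwise (\<lambda>r s. \<not> isomorphic_orderings K r s) S) \<and>
         (\<exists>S :: real rel set. S \<approx> Pow (UNIV :: real set) \<and>
            (\<forall>r \<in> S. field_ordering K r \<and> \<not> archimedean K r) \<and>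
            pairwise (\<lambda>r s. \<not> isomorphic_orderings K r s) S)"
proof -
  define F where "F = {a \<in> A. 0 \<le> a}"
  define V where "V = F \<union> A'"
  define g where "g x = (if x \<in> F then sqrt x else x)" for x
  have "V \<subseteq> A \<union> A'" by (auto simp: V_def F_def)
  then have "polys_over V \<subseteq> polys_over (A \<union> A')" by (auto simp: polys_over_def)
  then have V: "alg_indep of_rat (\<lambda>x. x) V"
    using assms(8) unfolding algebraically_independent_over_rat_iff alg_indep_def by blast
  have g: "alg_indep of_rat g V"
    unfolding g_def using alg_indep_sqrt_on[OF V, of F] by (simp add: F_def)
  \<comment> \<open>Disjointness of \<open>A\<close> and \<open>A'\<close> ensures that
    \<open>g\<close> is the identity on \<open>A'\<close>.\<close>
  have "g ` V = {sqrt a | a. a \<in> A \<and> a \<ge> 0} \<union> A'"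
    using assms(1) by (force simp: V_def g_def F_def)
  then have K: "K = rat_adjoin (g ` V)" using assms(9) by simp
  \<comment> \<open>Both sets are taken inside \<open>A'\<close>, hence inside \<open>V\<close>. The
    set \<open>C\<close> encodes the choice of ordering, while \<open>B\<close> keeps the
    transcendence degree at the continuum.\<close>
  obtain B C where BC: "B \<subseteq> A'" "C \<subseteq> A'" "B \<inter> C = {}"
    "B \<approx> (UNIV :: real set)" "C \<approx> (UNIV :: real set)"
    using eqpoll_UNIV_real_split[OF assms(3)] .
  obtain b where b: "b \<in> B" using BC(4) by (metis ex_in_conv eqpoll_empty_iff_empty eqpoll_sym UNIV_not_empty)
  \<comment> \<open>\<open>B\<close> alone has continuum size, so \<open>B \<union> D\<close> is
    equipollent to \<open>V\<close> for every \<open>D\<close>, even the empty one.\<close>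
  have bij: "\<exists>\<phi>. bij_betw \<phi> V (B \<union> D)" if "D \<subseteq> C" for D
  proof -
    have "V \<lesssim> B \<union> D"
      by (rule lepoll_trans[OF lepoll_trans2[OF subset_imp_lepoll[OF subset_UNIV] eqpoll_sym[OF BC(4)]]
            subset_imp_lepoll[OF Un_upper1]])
    moreover have "B \<union> D \<lesssim> V"
      using BC that by (intro subset_imp_lepoll) (auto simp: V_def)
    ultimately have "V \<approx> B \<union> D" by (rule lepoll_antisym)
    then show ?thesis by (simp add: eqpoll_def)
  qed
  have arch: "\<exists>r. (field_ordering K r \<and> archimedean K r) \<and> realized_cuts (carrier K) r \<inter> C = D"
    if D: "D \<subseteq> C" for D
  proof -
    obtain \<phi> where \<phi>: "bij_betw \<phi> V (B \<union> D)" using bij[OF D] by blast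
    then have im: "inj_on \<phi> V" "\<phi> ` V = B \<union> D" "B \<union> D \<subseteq> V"
      using BC D by (auto simp: bij_betw_def V_def)
    obtain r where r: "field_ordering K r" "archimedean K r" "B \<union> D \<subseteq> realized_cuts (carrier K) r"
      "realized_cuts (carrier K) r \<subseteq> fractions (\<lambda>x. x) (B \<union> D)"
      using archimedean_ordering_exists[OF g V im(1)] im(2,3) unfolding K by metis
    \<comment> \<open>By independence an element of \<open>C\<close> in the field generated by
      \<open>B \<union> D\<close> already belongs to \<open>B \<union> D\<close>, and it is not in
      \<open>B\<close>.\<close>
    have "realized_cuts (carrier K) r \<inter> C \<subseteq> D"
    proof
      fix x assume x: "x \<in> realized_cuts (carrier K) r \<inter> C"
      then have "x \<in> V" "x \<in> fractions (\<lambda>x. x) (B \<union> D)"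
        using r(4) BC(2) by (auto simp: V_def)
      from fractions_inter_subset[OF V im(3) this] show "x \<in> D"
        using x BC(3) by blast
    qed
    then show ?thesis using r D by blast
  qed
  have nonarch: "\<exists>r. (field_ordering K r \<and> \<not> archimedean K r) \<and> realized_cuts (carrier K) r \<inter> C = D"
    if D: "D \<subseteq> C" for D
  proof -
    obtain \<phi> where \<phi>: "bij_betw \<phi> V (B \<union> D)" using bij[OF D] by blast
    \<comment> \<open>The index made infinitely large is the one mapped to \<open>b\<close> in
      \<open>B\<close>. Its loss does not touch \<open>D\<close>, because \<open>B\<close> and
      \<open>C\<close> are disjoint.\<close>
    then obtain t where t: "t \<in> V" "\<phi> t = b"
      using b unfolding bij_betw_def by (metis UnI1 imageE)
    have im: "inj_on \<phi> V" "\<phi> ` V \<subseteq> V" "\<phi> ` (V - {t}) = (B - {b}) \<union> D" "(B - {b}) \<union> D \<subseteq> V"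
    proof -
      show "\<phi> ` V \<subseteq> V" and "(B - {b}) \<union> D \<subseteq> V" and inj: "inj_on \<phi> V"
        using \<phi> BC(1,2) D by (auto simp: bij_betw_def V_def)
      have "\<phi> ` (V - {t}) = \<phi> ` V - {\<phi> t}"
        using inj_on_image_set_diff[OF inj, of V "{t}"] t(1) by simp
      then show "\<phi> ` (V - {t}) = (B - {b}) \<union> D"
        using \<phi> t b BC(3) D by (auto simp: bij_betw_def)
    qed
    obtain r where r: "field_ordering K r" "\<not> archimedean K r"
      "(B - {b}) \<union> D \<subseteq> realized_cuts (carrier K) r"
      "realized_cuts (carrier K) r \<subseteq> fractions (\<lambda>x. x) ((B - {b}) \<union> D)"
      using nonarchimedean_ordering_exists[OF g V im(1,2) t(1)] unfolding K im(3) by blast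
    have "realized_cuts (carrier K) r \<inter> C \<subseteq> D"
    proof
      fix x assume x: "x \<in> realized_cuts (carrier K) r \<inter> C"
      then have "x \<in> V" "x \<in> fractions (\<lambda>x. x) ((B - {b}) \<union> D)"
        using r(4) BC(2) by (auto simp: V_def)
      from fractions_inter_subset[OF V im(4) this] show "x \<in> D"
        using x BC(3) by blast
    qed
    then show ?thesis using r D by blast
  qed
  show ?thesis
    by (intro conjI pairwise_nonisomorphic_family[OF BC(5) K] arch nonarch)
qed

end
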